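(* Let $\{A_t\}_{t\ge0}$ be a sequence of random $m\times n$ real matrices and let $\mathcal{F}_t:=\sigma(A_0,\ldots,A_t)$ be its natural filtration. Assume $\{A_t\}$ is a martingale difference sequence, i.e. $\mathbb{E}[A_0]=0$ and $\mathbb{E}[A_t\mid\mathcal{F}_{t-1}]=0$ for each $t\ge1$, and that $\mathbb{E}[A_tA_t^T]$ is well-defined (finite) for every $t$. Then, for any symmetric positive definite $\Lambda\in\mathbb{R}^{m\times m}$ and any $q\in[1,2]$, $$\mathbb{E}\Big[\Big\|\sum_{t=0}^{k-1}A_t\Big\|_{S_q}^2\Big]\le\|\Lambda\|_{S_{\frac{q}{2-q}}}\sum_{t=0}^{k-1}\mathrm{Tr}\big(\mathbb{E}[A_tA_t^T]\Lambda^{-1}\big)\qquad\forall k\ge1,$$ where $S_{\frac{q}{2-q}}$ is interpreted as $S_\infty$ when $q=2$.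
   Context: For $r\in[1,\infty]$, $\|Z\|_{S_r}$ is the Schatten-$r$ norm, i.e. the $\ell_r$ norm of the vector of singular values of $Z$. *)

theory Defs
  imports "HOL-Probability.Probability" "HOL-Computational_Algebra.Polynomial"
begin

definition char_polynomial :: "'a::comm_ring_1 ^ 'n ^ 'n \<Rightarrow> 'a poly" where
  "char_polynomial A = det (\<chi> i j. (if i = j then [:0, 1:] else 0) - [:A $ i $ j:])"

text \<open>
  The square roots of the eigenvalues of \<open>Z\<^sup>T Z\<close>, counted with algebraic multiplicity.
  There are as many of them as columns of \<open>Z\<close>; compared with the convention that keeps only
  the first \<open>min m n\<close> values, the surplus ones are zeros, which do not affect the
  \<open>\<ell>\<^sub>r\<close> norms below.
\<close>
definition singular_values :: "real ^ 'n ^ 'm \<Rightarrow> real multiset" where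
  "singular_values Z = image_mset sqrt (proots (char_polynomial (transpose Z ** Z)))"

definition lr_norm :: "ereal \<Rightarrow> real multiset \<Rightarrow> real" where
  "lr_norm r S =
     (if r = \<infinity> then Max ((\<lambda>s. \<bar>s\<bar>) ` set_mset S)
      else (\<Sum>s\<in>#S. \<bar>s\<bar> powr real_of_ereal r) powr (1 / real_of_ereal r))"

text \<open>Meaningful for \<open>1 \<le> r \<le> \<infinity>\<close>.\<close>
definition schatten_norm :: "ereal \<Rightarrow> real ^ 'n ^ 'm \<Rightarrow> real" where
  "schatten_norm r Z = lr_norm r (singular_values Z)"

definition sym_pos_def :: "real ^ 'n ^ 'n \<Rightarrow> bool" where
  "sym_pos_def L \<longleftrightarrow> transpose L = L \<and> (\<forall>x. x \<noteq> 0 \<longrightarrow> 0 < x \<bullet> (L *v x))"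

definition natural_filtration ::
    "'a measure \<Rightarrow> (nat \<Rightarrow> 'a \<Rightarrow> 'b::topological_space) \<Rightarrow> nat \<Rightarrow> 'a measure" where
  "natural_filtration M X t =
     sigma (space M) (\<Union>s\<in>{..t}. {X s -` B \<inter> space M | B. B \<in> sets borel})"

text \<open>The library's conditional expectation is real-valued, so it is taken entrywise.\<close>
definition matrix_cond_exp ::
    "'a measure \<Rightarrow> 'a measure \<Rightarrow> ('a \<Rightarrow> real ^ 'n ^ 'm) \<Rightarrow> 'a \<Rightarrow> real ^ 'n ^ 'm" where
  "matrix_cond_exp M F X = (\<lambda>\<omega>. \<chi> i j. real_cond_exp M F (\<lambda>\<omega>'. X \<omega>' $ i $ j) \<omega>)"

text \<open>
  Integrability (which includes measurability) is required explicitly because the integral and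
  the conditional expectation are total functions with default values.
\<close>
definition martingale_difference ::
    "'a measure \<Rightarrow> (nat \<Rightarrow> 'a \<Rightarrow> real ^ 'n ^ 'm) \<Rightarrow> bool" where
  "martingale_difference M A \<longleftrightarrow>
     (\<forall>t. integrable M (A t)) \<and>
     (\<integral>\<omega>. A 0 \<omega> \<partial>M) = 0 \<and>
     (\<forall>t\<ge>1. AE \<omega> in M. matrix_cond_exp M (natural_filtration M A (t - 1)) (A t) \<omega> = 0)"

end

(* If u_j are the left singular vectors of Z, s_j its singular values and a_j = u_j . L u_j, then
   Tr(Z Z^T L^-1) = sum s_j^2 (u_j . L^-1 u_j) >= sum s_j^2 / a_j by Cauchy-Schwarz. Hoelder's
   inequality bounds (sum s_j^q)^(2/q) by (sum s_j^2 / a_j) (sum a_j^r)^(1/r) with r = q / (2 - q),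
   and sum a_j^r is at most the sum of the r-th powers of the eigenvalues of L, by Jensen and Bessel.
   This gives the inequality pointwise, with Z the partial sum of the A_t; taking expectations,
   the mixed terms vanish because martingale differences are orthogonal. *)
theory Submission
  imports Defs
begin

text \<open>Singular values are given as roots of a characteristic polynomial, whereas the argument
  needs singular vectors. Orthonormal eigenbases of \<open>transpose Z ** Z\<close> and of
  \<open>\<Lambda>\<close> bridge the two. The vectors u_j exist only for nonzero singular values,
  so they form an orthonormal system that may fail to span. All that is kept of the geometry is the
  array of weights (u_j . w_i)^2, w_i being the eigenvectors of \<open>\<Lambda>\<close>: each row
  sums to 1, each column to at most 1. This turns the matrix inequality into one about nonnegative
  reals. The exponent q / (2 - q) degenerates at q = 2, so this endpoint gets its own scalar
  inequality, with a maximum in place of a power sum. Taking expectations needs the Schatten norm to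
  be a measurable function of the matrix. Eigenvectors chosen matrix by matrix carry no
  measurability, so it has to come from symmetric functions of the spectrum that are continuous in
  the entries.\<close>

section \<open>Spectral theorem for symmetric matrices\<close>

text \<open>The quadratic form \<open>x \<bullet> f x\<close> attains its maximum c on the unit
  sphere of \<open>V\<close>; perturbing a maximiser in the direction of the residual
  \<open>f x - c *\<^sub>R x\<close> shows that the residual vanishes.\<close>

lemma selfadjoint_eigenvector_in_subspace:
  fixes f :: "'a::euclidean_space \<Rightarrow> 'a"
  assumes lin: "linear f" and sa: "\<And>x y. f x \<bullet> y = x \<bullet> f y"
    and V: "subspace V" "V \<noteq> {0}" and inv: "\<And>x. x \<in> V \<Longrightarrow> f x \<in> V"
  obtains x c where "x \<in> V" "norm x = 1" "f x = c *\<^sub>R x"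
proof -
  let ?S = "sphere 0 1 \<inter> V"
  from V obtain v where v: "v \<in> V" "v \<noteq> 0"
    using subspace_0 by blast
  have "v /\<^sub>R norm v \<in> ?S"
    using v V(1) by (auto simp: subspace_scale)
  then have ne: "?S \<noteq> {}" by blast
  have "compact ?S"
    by (intro compact_Int_closed closed_subspace V) auto
  moreover have "continuous_on ?S (\<lambda>x. x \<bullet> f x)"
    by (intro continuous_intros linear_continuous_on linear_conv_bounded_linear[THEN iffD1] lin)
  ultimately obtain x where x: "x \<in> ?S" and max: "\<And>y. y \<in> ?S \<Longrightarrow> y \<bullet> f y \<le> x \<bullet> f x"
    using ne continuous_attains_sup by metis
  define c where "c = x \<bullet> f x"
  have le: "y \<bullet> f y \<le> c * (y \<bullet> y)" if "y \<in> V" for y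
  proof (cases "y = 0")
    case False
    have "y /\<^sub>R norm y \<in> ?S"
      using that False V(1) by (auto simp: subspace_scale)
    from max[OF this] have "(y \<bullet> f y) / (norm y)\<^sup>2 \<le> c"
      by (simp add: linear_scale[OF lin] c_def power2_eq_square divide_simps)
    then show ?thesis
      using False by (simp add: divide_simps power2_norm_eq_inner)
  qed (simp add: linear_0[OF lin])
  define z where "z = f x - c *\<^sub>R x"
  have zV: "z \<in> V"
    using x V(1) inv by (auto simp: z_def intro!: subspace_diff subspace_scale)
  define K where "K = c * (z \<bullet> z) - z \<bullet> f z"
  have xx: "x \<bullet> x = 1"
    using x by (simp add: dot_square_norm)
  \<comment> \<open>This is \<open>le\<close> at \<open>x + t *\<^sub>R z\<close>: the constant
    terms and the multiples of \<open>z \<bullet> x\<close> cancel. A term linear in t is then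
    bounded by a quadratic one, which fails for small t > 0 unless z = 0.\<close>
  have ineq: "2 * t * (z \<bullet> z) \<le> t\<^sup>2 * K" for t
  proof -
    have "x + t *\<^sub>R z \<in> V"
      using x zV V(1) by (auto intro!: subspace_add subspace_scale)
    from le[OF this]
    have *: "c + 2 * t * (z \<bullet> f x) + t\<^sup>2 * (z \<bullet> f z) \<le> c * (1 + 2 * t * (z \<bullet> x) + t\<^sup>2 * (z \<bullet> z))"
      using sa[of x z]
      by (simp add: linear_add[OF lin] linear_scale[OF lin] inner_simps xx power2_eq_square
          inner_commute[of x z] inner_commute[of "f x" z] c_def[symmetric] distrib_left)
    have "z \<bullet> f x = z \<bullet> z + c * (z \<bullet> x)"
      by (simp add: z_def algebra_simps)
    with * show ?thesis
      by (simp add: K_def algebra_simps)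
  qed
  have "z \<bullet> z = 0"
  proof (rule ccontr)
    assume "z \<bullet> z \<noteq> 0"
    then have pos: "z \<bullet> z > 0" by (simp add: order_less_le)
    \<comment> \<open>Chosen so that \<open>t * (\<bar>K\<bar> + 1)\<close> is exactly
      \<open>z \<bullet> z\<close>; the 1 guards against K = 0.\<close>
    define t where "t = (z \<bullet> z) / (\<bar>K\<bar> + 1)"
    have t: "t > 0" using pos by (simp add: t_def)
    from ineq[of t] t have "2 * (z \<bullet> z) \<le> t * K"
      by (simp add: power2_eq_square)
    also have "\<dots> \<le> t * (\<bar>K\<bar> + 1)"
      using t by (intro mult_left_mono) auto
    also have "\<dots> = z \<bullet> z"
      by (simp add: t_def)
    finally show False using pos by simp
  qed
  then have "f x = c *\<^sub>R x"
    by (simp add: z_def)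
  with x that show ?thesis by auto
qed

text \<open>Induction on the dimension: by self-adjointness, the orthogonal complement of an
  eigenvector within \<open>V\<close> is again invariant, and one dimension smaller.\<close>

lemma selfadjoint_orthonormal_eigenvectors:
  fixes f :: "'a::euclidean_space \<Rightarrow> 'a"
  assumes lin: "linear f" and sa: "\<And>x y. f x \<bullet> y = x \<bullet> f y"
    and "subspace V" and "\<And>x. x \<in> V \<Longrightarrow> f x \<in> V"
  shows "\<exists>B\<subseteq>V. finite B \<and> card B = dim V \<and> pairwise orthogonal B \<and>
           (\<forall>b\<in>B. norm b = 1 \<and> (\<exists>c. f b = c *\<^sub>R b))"
  using assms(3,4)
proof (induction "dim V" arbitrary: V)
  case 0
  then show ?case by (intro exI[of _ "{}"]) auto
next
  case (Suc n)
  have "V \<noteq> {0}" using Suc.hyps(2) by auto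
  then obtain x c where x: "x \<in> V" "norm x = 1" "f x = c *\<^sub>R x"
    using selfadjoint_eigenvector_in_subspace[OF lin sa Suc.prems(1)] Suc.prems(2) by metis
  define W where "W = {y \<in> V. \<forall>u \<in> span {x}. orthogonal u y}"
  have W_iff: "y \<in> W \<longleftrightarrow> y \<in> V \<and> x \<bullet> y = 0" for y
    by (auto simp: W_def span_singleton orthogonal_def)
  have xn: "x \<noteq> 0" using x by auto
  have "dim W + dim (span {x}) = dim V"
    unfolding W_def using x Suc.prems(1)
    by (intro dim_subspace_orthogonal_to_vectors) (auto simp: span_minimal)
  then have dimW: "n = dim W"
    using Suc.hyps(2) xn by (simp add: dim_span)
  have subW: "subspace W"
    using Suc.prems(1) by (auto simp: subspace_def W_iff inner_simps)
  have invW: "f y \<in> W" if "y \<in> W" for y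
    using that sa[of x y] x(3) Suc.prems(2) by (auto simp: W_iff)
  obtain B where B: "B \<subseteq> W" "finite B" "card B = dim W" "pairwise orthogonal B"
      "\<forall>b\<in>B. norm b = 1 \<and> (\<exists>c. f b = c *\<^sub>R b)"
    using Suc.hyps(1)[OF dimW subW invW] by auto
  have "x \<notin> B"
    using B(1) xn by (auto simp: W_iff)
  moreover have "pairwise orthogonal (insert x B)"
    using B(1,4) by (auto simp: pairwise_insert W_iff orthogonal_def inner_commute)
  ultimately show ?case
    using B x dimW Suc.hyps(2)
    by (intro exI[of _ "insert x B"]) (auto simp: W_iff)
qed

text \<open>Indexing by the coordinate type \<open>'n\<close> fixes the number of vectors, so
  orthonormality alone makes them a basis; a family of eigenvalues, unlike a set, also records
  multiplicities.\<close>

definition orthonormal_eigenbasis :: "real^'n^'n \<Rightarrow> ('n \<Rightarrow> real^'n) \<Rightarrow> ('n \<Rightarrow> real) \<Rightarrow> bool" where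
  "orthonormal_eigenbasis X w d \<longleftrightarrow>
     (\<forall>i j. w i \<bullet> w j = (if i = j then 1 else 0)) \<and> (\<forall>i. X *v w i = d i *\<^sub>R w i)"

lemma orthonormal_eigenbasis_exists:
  fixes X :: "real^'n^'n"
  assumes "transpose X = X"
  obtains w d where "orthonormal_eigenbasis X w d"
proof -
  have sa: "(X *v x) \<bullet> y = x \<bullet> (X *v y)" for x y
    using assms by (metis dot_lmul_matrix matrix_transpose_mul transpose_matrix_vector transpose_transpose)
  have "\<exists>B\<subseteq>UNIV. finite B \<and> card B = dim (UNIV :: (real^'n) set) \<and> pairwise orthogonal B \<and>
           (\<forall>b\<in>B. norm b = 1 \<and> (\<exists>c. X *v b = c *\<^sub>R b))"
    by (rule selfadjoint_orthonormal_eigenvectors) (auto simp: sa)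
  then obtain B where B: "finite B" "card B = CARD('n)" "pairwise orthogonal B"
      "\<And>b. b \<in> B \<Longrightarrow> norm b = 1" "\<forall>b\<in>B. \<exists>c. X *v b = c *\<^sub>R b"
    by auto
  obtain w where w: "bij_betw w (UNIV :: 'n set) B"
    using B(1,2) by (metis finite_class.finite_UNIV finite_same_card_bij)
  obtain c where c: "\<And>b. b \<in> B \<Longrightarrow> X *v b = c b *\<^sub>R b"
    using B(5) by metis
  have wB: "w i \<in> B" for i
    using w by (auto simp: bij_betw_def)
  have "w i \<bullet> w j = (if i = j then 1 else 0)" for i j
    using wB B(3,4) w by (auto simp: pairwise_def orthogonal_def bij_betw_def dot_square_norm inj_eq)
  then have "orthonormal_eigenbasis X w (c \<circ> w)"
    using c wB by (simp add: orthonormal_eigenbasis_def)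
  then show ?thesis by (rule that)
qed

lemma orthonormal_basis_expansion:
  fixes w :: "'n \<Rightarrow> real^'n"
  assumes w: "\<And>i j. w i \<bullet> w j = (if i = j then 1 else 0)"
  shows "(\<Sum>i\<in>UNIV. (x \<bullet> w i) *\<^sub>R w i) = x"
proof -
  have inj: "inj w"
    by (rule injI) (metis w zero_neq_one)
  have po: "pairwise orthogonal (range w)"
    by (auto simp: pairwise_def orthogonal_def w)
  have n1: "norm b = 1" if "b \<in> range w" for b
    using that w by (auto simp: norm_eq_1)
  have "0 \<notin> range w"
    using n1[of 0] by auto
  then have ind: "independent (range w)"
    by (rule pairwise_orthogonal_independent[OF po])
  have "card (range w) = DIM(real^'n)"
    by (simp add: card_image inj)
  then have "span (range w) = UNIV"
    using ind by (metis dim_eq_card dim_eq_full)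
  then have "(\<Sum>b\<in>range w. (x \<bullet> b) *\<^sub>R b) = x"
    by (intro orthonormal_basis_expand po n1) auto
  then show ?thesis
    by (simp add: sum.reindex inj)
qed

lemma orthonormal_basis_inner:
  fixes w :: "'n \<Rightarrow> real^'n"
  assumes w: "\<And>i j. w i \<bullet> w j = (if i = j then 1 else 0)"
  shows "(\<Sum>i\<in>UNIV. (x \<bullet> w i) * (y \<bullet> w i)) = x \<bullet> y"
proof -
  have "x \<bullet> y = x \<bullet> (\<Sum>i\<in>UNIV. (y \<bullet> w i) *\<^sub>R w i)"
    by (simp add: orthonormal_basis_expansion[OF w])
  also have "\<dots> = (\<Sum>i\<in>UNIV. (x \<bullet> w i) * (y \<bullet> w i))"
    by (simp add: inner_sum_right mult.commute)
  finally show ?thesis by simp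
qed

section \<open>Singular values from an eigenbasis\<close>

text \<open>Diagonalisation over the polynomial ring: with the eigenvectors as columns of the
  constant matrix \<open>P\<close>, one has \<open>C ** P = P ** D\<close>. Orthonormality makes
  \<open>det P\<close> nonzero, so it cancels from the determinants.\<close>

lemma char_polynomial_eigenbasis:
  fixes X :: "real^'n^'n"
  assumes "orthonormal_eigenbasis X w d"
  shows "char_polynomial X = (\<Prod>i\<in>UNIV. [:- d i, 1:])"
proof -
  have w: "w i \<bullet> w j = (if i = j then 1 else 0)" and Xw: "X *v w i = d i *\<^sub>R w i" for i j
    using assms by (auto simp: orthonormal_eigenbasis_def)
  define P :: "real poly^'n^'n" where "P = (\<chi> i j. [:w j $ i:])"
  define C :: "real poly^'n^'n" where
    "C = (\<chi> i j. (if i = j then [:0, 1:] else 0) - [:X $ i $ j:])"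
  define D :: "real poly^'n^'n" where "D = (\<chi> i j. if i = j then [:- d i, 1:] else 0)"
  have const_sum: "(\<Sum>k\<in>K. [:g k:]) = [:\<Sum>k\<in>K. g k:]" for K :: "'n set" and g :: "'n \<Rightarrow> real"
    by (induction K rule: infinite_finite_induct) auto
  have PP: "transpose P ** P = mat 1"
    using w
    by (auto simp: vec_eq_iff matrix_matrix_mult_def transpose_def P_def mat_def const_sum
        inner_vec_def one_pCons)
  have CP: "C ** P = P ** D"
  proof -
    have "(C ** P) $ i $ j = (P ** D) $ i $ j" for i j
    proof -
      have "(C ** P) $ i $ j =
          (\<Sum>k\<in>UNIV. (if i = k then [:0, w j $ k:] else 0) - [:X $ i $ k * w j $ k:])"
        by (auto simp: C_def P_def matrix_matrix_mult_def algebra_simps intro!: sum.cong)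
      also have "\<dots> = [:0, w j $ i:] - (\<Sum>k\<in>UNIV. [:X $ i $ k * w j $ k:])"
        by (simp add: sum_subtractf)
      also have "(\<Sum>k\<in>UNIV. [:X $ i $ k * w j $ k:]) = [:(X *v w j) $ i:]"
        by (simp add: const_sum matrix_vector_mult_def)
      also have "[:0, w j $ i:] - [:(X *v w j) $ i:] = (P ** D) $ i $ j"
        by (simp add: Xw D_def P_def matrix_matrix_mult_def if_distrib cong: if_cong)
      finally show ?thesis .
    qed
    then show ?thesis by (simp add: vec_eq_iff)
  qed
  have "det P * det P = 1"
    using arg_cong[OF PP, of det] by (simp add: det_mul)
  then have "det P \<noteq> 0" by auto
  moreover have "det C * det P = det P * det D"
    using arg_cong[OF CP, of det] by (simp add: det_mul)
  ultimately have "det C = det D" by simp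
  also have "det D = (\<Prod>i\<in>UNIV. [:- d i, 1:])"
    by (subst det_diagonal) (auto simp: D_def)
  finally show ?thesis
    by (simp add: char_polynomial_def C_def)
qed

lemma singular_values_eigenbasis:
  fixes Z :: "real^'n^'m"
  assumes "orthonormal_eigenbasis (transpose Z ** Z) w d"
  shows "singular_values Z = image_mset (\<lambda>i. sqrt (d i)) (mset_set UNIV)"
proof -
  have "proots (char_polynomial (transpose Z ** Z)) = (\<Sum>i\<in>UNIV. {#d i#})"
    by (simp add: char_polynomial_eigenbasis[OF assms] proots_prod)
  also have "\<dots> = image_mset d (mset_set UNIV)"
    by (simp add: sum_unfold_sum_mset)
  finally show ?thesis
    by (simp add: singular_values_def multiset.map_comp o_def)
qed

lemma lr_norm_image_mset:
  assumes "r \<noteq> 0"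
  shows "lr_norm (ereal r) (image_mset f (mset_set (UNIV::'n::finite set))) =
     (\<Sum>i\<in>UNIV. \<bar>f i\<bar> powr r) powr (1 / r)"
  by (simp add: lr_norm_def multiset.map_comp o_def sum_unfold_sum_mset)

section \<open>Scalar inequalities\<close>

text \<open>After division by the two totals, Young's inequality applies termwise and its right-hand
  sides add up to 1. A vanishing total forces all its terms to be 0 and is treated
  separately.\<close>

lemma Holder_powr_sum:
  fixes x y :: "'i \<Rightarrow> real"
  assumes "finite J" and x: "\<And>j. j \<in> J \<Longrightarrow> x j \<ge> 0" and y: "\<And>j. j \<in> J \<Longrightarrow> y j \<ge> 0"
    and th: "0 < th" "th < 1"
  shows "(\<Sum>j\<in>J. x j powr th * y j powr (1 - th)) \<le> (\<Sum>j\<in>J. x j) powr th * (\<Sum>j\<in>J. y j) powr (1 - th)"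
proof (cases "(\<Sum>j\<in>J. x j) = 0 \<or> (\<Sum>j\<in>J. y j) = 0")
  case True
  then have "(\<forall>j\<in>J. x j = 0) \<or> (\<forall>j\<in>J. y j = 0)"
    using assms by (auto simp: sum_nonneg_eq_0_iff)
  then have "(\<Sum>j\<in>J. x j powr th * y j powr (1 - th)) = 0"
    using th by (intro sum.neutral) auto
  then show ?thesis by simp
next
  case False
  define X where "X = (\<Sum>j\<in>J. x j)"
  define Y where "Y = (\<Sum>j\<in>J. y j)"
  have XY: "X > 0" "Y > 0"
    using False x y sum_nonneg[of J x] sum_nonneg[of J y] by (auto simp: X_def Y_def order_less_le)
  have young: "a powr th * b powr (1 - th) \<le> th * a + (1 - th) * b" if "a \<ge> 0" "b \<ge> 0" for a b
    using Youngs_inequality_0[of th "1 - th" a b] that th by (cases "a = 0 \<or> b = 0") auto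
  have "(\<Sum>j\<in>J. x j powr th * y j powr (1 - th))
      = X powr th * Y powr (1 - th) * (\<Sum>j\<in>J. (x j / X) powr th * (y j / Y) powr (1 - th))"
    using XY x y by (simp add: sum_distrib_left powr_divide)
  also have "\<dots> \<le> X powr th * Y powr (1 - th) * (\<Sum>j\<in>J. th * (x j / X) + (1 - th) * (y j / Y))"
    using XY by (intro mult_left_mono sum_mono young divide_nonneg_pos x y) auto
  also have "(\<Sum>j\<in>J. th * (x j / X) + (1 - th) * (y j / Y)) = th * (X / X) + (1 - th) * (Y / Y)"
    by (simp only: X_def Y_def sum.distrib sum_distrib_left sum_divide_distrib)
  also have "\<dots> = 1"
    using XY by simp
  finally show ?thesis
    by (simp add: X_def Y_def)
qed

text \<open>In the application \<open>s j = \<sigma>\<^sub>j\<^sup>2\<close> for the nonzero singular values \<open>\<sigma>\<^sub>j\<close> of a matrix \<open>Z\<close>, \<open>l i\<close> are the eigenvalues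
  of \<open>\<Lambda>\<close>, and \<open>c j i = (u\<^sub>j \<bullet> w\<^sub>i)\<^sup>2\<close> for the left singular vectors \<open>u\<^sub>j\<close> of \<open>Z\<close> and the
  eigenvectors \<open>w\<^sub>i\<close> of \<open>\<Lambda>\<close>.\<close>
lemma weighted_powr_sum_bound:
  fixes c :: "'j \<Rightarrow> 'i::finite \<Rightarrow> real"
  assumes J: "finite J" and c: "\<And>j i. j \<in> J \<Longrightarrow> c j i \<ge> 0"
    and row: "\<And>j. j \<in> J \<Longrightarrow> (\<Sum>i\<in>UNIV. c j i) = 1"
    and col: "\<And>i. (\<Sum>j\<in>J. c j i) \<le> 1"
    and l: "\<And>i. l i > 0" and s: "\<And>j. j \<in> J \<Longrightarrow> s j > 0"
    and q: "1 \<le> q" "q < 2"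
  shows "(\<Sum>j\<in>J. s j powr (q / 2)) powr (2 / q) \<le>
    (\<Sum>i\<in>UNIV. l i powr (q / (2 - q))) powr (1 / (q / (2 - q))) *
      (\<Sum>j\<in>J. s j * (\<Sum>i\<in>UNIV. c j i / l i))"
proof -
  define r where "r = q / (2 - q)"
  have r: "r \<ge> 1" using q by (simp add: r_def)
  \<comment> \<open>In the application \<open>a j\<close> is u_j . L u_j and \<open>b j\<close> is
    u_j . L^-1 u_j, both expanded in the eigenvectors of L.\<close>
  define a where "a j = (\<Sum>i\<in>UNIV. c j i * l i)" for j
  define b where "b j = (\<Sum>i\<in>UNIV. c j i / l i)" for j
  have a_nn: "a j \<ge> 0" and b_nn: "b j \<ge> 0" if "j \<in> J" for j
    using c[OF that] l less_imp_le[OF l] by (auto simp: a_def b_def intro!: sum_nonneg mult_nonneg_nonneg divide_nonneg_pos)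
  have ab: "1 \<le> a j * b j" if "j \<in> J" for j
  proof -
    \<comment> \<open>Each weight splits as sqrt(c l) sqrt(c / l), so the left side is the square of
      a row sum, that is 1.\<close>
    have "(\<Sum>i\<in>UNIV. sqrt (c j i * l i) * sqrt (c j i / l i))\<^sup>2
        \<le> (\<Sum>i\<in>UNIV. (sqrt (c j i * l i))\<^sup>2) * (\<Sum>i\<in>UNIV. (sqrt (c j i / l i))\<^sup>2)"
      by (rule Cauchy_Schwarz_ineq_sum)
    also have "\<dots> = a j * b j"
      unfolding a_def b_def using c[OF that] l less_imp_le[OF l] by (simp add: divide_nonneg_pos)
    finally have "(\<Sum>i\<in>UNIV. sqrt (c j i * l i) * sqrt (c j i / l i))\<^sup>2 \<le> a j * b j" .
    moreover have "sqrt (c j i * l i) * sqrt (c j i / l i) = c j i" for i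
      using c[OF that] l[of i] by (simp flip: real_sqrt_mult)
    ultimately show ?thesis
      using row[OF that] by simp
  qed
  have a_pos: "a j > 0" if "j \<in> J" for j
    using ab[OF that] a_nn[OF that] by (cases "a j = 0") auto
  \<comment> \<open>A row of \<open>c\<close> is a probability vector, and x^r is convex because
    \<open>q \<ge> 1\<close> gives \<open>r \<ge> 1\<close>.\<close>
  have jensen: "a j powr r \<le> (\<Sum>i\<in>UNIV. c j i * l i powr r)" if "j \<in> J" for j
  proof -
    have "(\<Sum>i\<in>UNIV. c j i *\<^sub>R l i) powr r \<le> (\<Sum>i\<in>UNIV. c j i * l i powr r)"
      using c[OF that] row[OF that] l by (intro convex_on_sum[OF _ _ powr_convex[OF r]]) auto
    then show ?thesis by (simp add: a_def)
  qed
  have "(\<Sum>j\<in>J. a j powr r) \<le> (\<Sum>j\<in>J. \<Sum>i\<in>UNIV. c j i * l i powr r)"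
    by (intro sum_mono jensen)
  also have "\<dots> = (\<Sum>i\<in>UNIV. (\<Sum>j\<in>J. c j i) * l i powr r)"
    by (subst sum.swap) (simp add: sum_distrib_right)
  also have "\<dots> \<le> (\<Sum>i\<in>UNIV. 1 * l i powr r)"
    by (intro sum_mono mult_right_mono col) auto
  finally have ar: "(\<Sum>j\<in>J. a j powr r) \<le> (\<Sum>i\<in>UNIV. l i powr r)" by simp
  \<comment> \<open>The exponent r is the one with r (1 - q / 2) = q / 2, which lets the powers of
    \<open>a j\<close> cancel. The factors are then ready for Hoelder with weights q / 2 and 1 - q /
    2.\<close>
  have "(\<Sum>j\<in>J. s j powr (q / 2)) = (\<Sum>j\<in>J. (s j / a j) powr (q / 2) * (a j powr r) powr (1 - q / 2))"
  proof (intro sum.cong refl)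
    fix j assume j: "j \<in> J"
    have "r * (1 - q / 2) = q / 2"
      using q by (simp add: r_def field_simps)
    then have "(a j powr r) powr (1 - q / 2) = a j powr (q / 2)"
      by (simp only: powr_powr)
    then show "s j powr (q / 2) = (s j / a j) powr (q / 2) * (a j powr r) powr (1 - q / 2)"
      using a_pos[OF j] s[OF j] by (simp add: powr_divide)
  qed
  also have "\<dots> \<le> (\<Sum>j\<in>J. s j / a j) powr (q / 2) * (\<Sum>j\<in>J. a j powr r) powr (1 - q / 2)"
    using q a_nn s by (intro Holder_powr_sum J) (auto simp: less_imp_le)
  also have "\<dots> \<le> (\<Sum>j\<in>J. s j * b j) powr (q / 2) * (\<Sum>i\<in>UNIV. l i powr r) powr (1 - q / 2)"
  proof (intro mult_mono powr_mono2 ar sum_mono sum_nonneg)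
    fix j assume j: "j \<in> J"
    show "s j / a j \<le> s j * b j"
      using ab[OF j] s[OF j] a_pos[OF j] by (simp add: field_simps)
    show "0 \<le> s j / a j"
      using s[OF j] a_pos[OF j] by simp
  qed (use q in auto)
  finally have "(\<Sum>j\<in>J. s j powr (q / 2)) powr (2 / q)
      \<le> ((\<Sum>j\<in>J. s j * b j) powr (q / 2) * (\<Sum>i\<in>UNIV. l i powr r) powr (1 - q / 2)) powr (2 / q)"
    using q by (intro powr_mono2 sum_nonneg) auto
  also have "\<dots> = (\<Sum>j\<in>J. s j * b j) * (\<Sum>i\<in>UNIV. l i powr r) powr (1 / r)"
  proof -
    have "(1 - q / 2) * (2 / q) = 1 / r"
      using q by (simp add: r_def field_simps)
    moreover have "0 \<le> (\<Sum>j\<in>J. s j * b j)"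
      using s b_nn by (intro sum_nonneg) (auto simp: less_imp_le)
    ultimately show ?thesis
      using q by (simp add: powr_mult powr_powr)
  qed
  finally show ?thesis
    by (simp add: r_def b_def mult.commute)
qed

text \<open>The endpoint q = 2: replacing \<open>l i\<close> by the largest eigenvalue in
  \<open>c j i = l i * (c j i / l i)\<close> and summing over a row bounds 1 by that eigenvalue
  times the weighted sum of inverses.\<close>

lemma weighted_sum_bound_Max:
  fixes c :: "'j \<Rightarrow> 'i::finite \<Rightarrow> real"
  assumes c: "\<And>j i. j \<in> J \<Longrightarrow> c j i \<ge> 0"
    and row: "\<And>j. j \<in> J \<Longrightarrow> (\<Sum>i\<in>UNIV. c j i) = 1"
    and l: "\<And>i. l i > 0" and s: "\<And>j. j \<in> J \<Longrightarrow> s j > 0"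
  shows "(\<Sum>j\<in>J. s j) \<le> Max (range l) * (\<Sum>j\<in>J. s j * (\<Sum>i\<in>UNIV. c j i / l i))"
proof -
  have "s j \<le> Max (range l) * (s j * (\<Sum>i\<in>UNIV. c j i / l i))" if j: "j \<in> J" for j
  proof -
    have "1 = (\<Sum>i\<in>UNIV. c j i)" using row[OF j] by simp
    also have "\<dots> \<le> (\<Sum>i\<in>UNIV. Max (range l) * (c j i / l i))"
    proof (intro sum_mono)
      fix i
      have "l i * (c j i / l i) \<le> Max (range l) * (c j i / l i)"
        using c[OF j] l[of i] by (intro mult_right_mono) (auto intro!: divide_nonneg_pos)
      then show "c j i \<le> Max (range l) * (c j i / l i)"
        using l[of i] by simp
    qed
    finally have "1 \<le> Max (range l) * (\<Sum>i\<in>UNIV. c j i / l i)"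
      by (simp add: sum_distrib_left)
    then have "s j * 1 \<le> s j * (Max (range l) * (\<Sum>i\<in>UNIV. c j i / l i))"
      using s[OF j] by (intro mult_left_mono) auto
    then show ?thesis by (simp add: mult_ac)
  qed
  then show ?thesis
    by (simp add: sum_distrib_left sum_mono)
qed

section \<open>The pointwise trace bound\<close>

lemma inner_transpose_mult:
  fixes Z :: "real^'n^'m"
  shows "x \<bullet> ((transpose Z ** Y) *v y) = (Z *v x) \<bullet> (Y *v y)"
  by (metis dot_lmul_matrix matrix_vector_mul_assoc transpose_matrix_vector transpose_transpose)

lemma trace_orthonormal_basis:
  fixes X :: "real^'n^'n" and w :: "'n \<Rightarrow> real^'n"
  assumes w: "\<And>i j. w i \<bullet> w j = (if i = j then 1 else 0)"
  shows "trace X = (\<Sum>j\<in>UNIV. w j \<bullet> (X *v w j))"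
proof -
  \<comment> \<open>Parseval at two coordinate vectors: entrywise, the projections w_j w_j^T add up
    to the identity.\<close>
  have *: "(\<Sum>j\<in>UNIV. w j $ a * w j $ b) = (if a = b then 1 else 0)" for a b
    using orthonormal_basis_inner[OF w, of "axis a 1" "axis b 1"]
    by (simp add: inner_axis') (auto simp: axis_def)
  have "(\<Sum>j\<in>UNIV. w j \<bullet> (X *v w j)) = (\<Sum>j\<in>UNIV. \<Sum>a\<in>UNIV. \<Sum>b\<in>UNIV. X $ a $ b * (w j $ a * w j $ b))"
    by (simp add: inner_vec_def matrix_vector_mult_def sum_distrib_left mult_ac)
  also have "\<dots> = (\<Sum>a\<in>UNIV. \<Sum>b\<in>UNIV. \<Sum>j\<in>UNIV. X $ a $ b * (w j $ a * w j $ b))"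
    by (subst sum.swap, rule sum.cong[OF refl], subst sum.swap) simp
  also have "\<dots> = (\<Sum>a\<in>UNIV. \<Sum>b\<in>UNIV. X $ a $ b * (if a = b then 1 else 0))"
    by (simp add: sum_distrib_left[symmetric] *)
  also have "\<dots> = trace X"
    by (simp add: trace_def if_distrib[of "\<lambda>t. _ * t"] cong: if_cong)
  finally show ?thesis by simp
qed

lemma Bessel_inequality:
  fixes u :: "'j \<Rightarrow> 'a::real_inner"
  assumes J: "finite J" and u: "\<And>i j. i \<in> J \<Longrightarrow> j \<in> J \<Longrightarrow> u i \<bullet> u j = (if i = j then 1 else 0)"
  shows "(\<Sum>j\<in>J. (u j \<bullet> x)\<^sup>2) \<le> x \<bullet> x"
proof -
  define p where "p = (\<Sum>j\<in>J. (u j \<bullet> x) *\<^sub>R u j)"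
  have px: "p \<bullet> x = (\<Sum>j\<in>J. (u j \<bullet> x)\<^sup>2)"
    by (simp add: p_def inner_sum_left power2_eq_square)
  have pu: "p \<bullet> u j = u j \<bullet> x" if "j \<in> J" for j
    using that J u by (simp add: p_def inner_sum_left if_distrib[of "\<lambda>t. _ * t"] cong: if_cong sum.cong)
  have "p \<bullet> p = p \<bullet> (\<Sum>j\<in>J. (u j \<bullet> x) *\<^sub>R u j)"
    by (simp add: p_def)
  also have "\<dots> = (\<Sum>j\<in>J. (u j \<bullet> x)\<^sup>2)"
    by (simp add: inner_sum_right pu power2_eq_square)
  finally have "(x - p) \<bullet> (x - p) = x \<bullet> x - (\<Sum>j\<in>J. (u j \<bullet> x)\<^sup>2)"
    by (simp add: inner_diff_left inner_diff_right inner_commute[of x p] px)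
  then show ?thesis
    by (metis diff_ge_0_iff_ge inner_ge_zero)
qed

lemma schatten_norm_eigenbasis:
  fixes Z :: "real^'n^'m"
  assumes "orthonormal_eigenbasis (transpose Z ** Z) w d" and "r \<noteq> 0"
  shows "schatten_norm (ereal r) Z = (\<Sum>i\<in>UNIV. \<bar>sqrt (d i)\<bar> powr r) powr (1 / r)"
  by (simp add: schatten_norm_def singular_values_eigenbasis[OF assms(1)] lr_norm_image_mset assms(2))

text \<open>The images \<open>Z *v v j\<close> are orthogonal with squared lengths
  \<open>d j\<close>; normalising the nonzero ones yields the left singular vectors.\<close>

lemma eigenvalue_gram_nonneg:
  fixes Z :: "real^'n^'m"
  assumes "orthonormal_eigenbasis (transpose Z ** Z) v d"
  shows "(Z *v v i) \<bullet> (Z *v v j) = (if i = j then d j else 0)" and "d j \<ge> 0"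
proof -
  show *: "(Z *v v i) \<bullet> (Z *v v j) = (if i = j then d j else 0)" for i
    using assms inner_transpose_mult[of "v i" Z Z "v j", symmetric]
    by (simp add: orthonormal_eigenbasis_def)
  show "d j \<ge> 0"
    using *[of j] inner_ge_zero[of "Z *v v j"] by simp
qed

lemma schatten_norm_sq_eigenbasis:
  fixes Z :: "real^'n^'m"
  assumes eb: "orthonormal_eigenbasis (transpose Z ** Z) w d" and r: "r > 0"
  shows "(schatten_norm (ereal r) Z)\<^sup>2 = (\<Sum>i\<in>UNIV. d i powr (r / 2)) powr (2 / r)"
proof -
  have "\<bar>sqrt (d i)\<bar> powr r = d i powr (r / 2)" for i
    using eigenvalue_gram_nonneg(2)[OF eb, of i] by (simp add: powr_powr flip: powr_half_sqrt)
  then have "(schatten_norm (ereal r) Z)\<^sup>2 = ((\<Sum>i\<in>UNIV. d i powr (r / 2)) powr (1 / r)) powr 2"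
    using schatten_norm_eigenbasis[OF eb] r by (simp add: schatten_norm_def)
  then show ?thesis
    by (simp add: powr_powr)
qed

lemma sym_pos_def_eigenvalue_pos:
  assumes "sym_pos_def L" and "orthonormal_eigenbasis L w l"
  shows "l i > 0"
proof -
  have w: "w i \<bullet> w i = 1" and Lw: "L *v w i = l i *\<^sub>R w i"
    using assms(2) by (auto simp: orthonormal_eigenbasis_def)
  then have "w i \<noteq> 0" by auto
  then have "0 < w i \<bullet> (L *v w i)"
    using assms(1) by (simp add: sym_pos_def_def)
  then show ?thesis by (simp add: Lw w)
qed

text \<open>Singular values of L are read off from \<open>transpose L ** L\<close>; for positive
  eigenvalues the square root returns \<open>l i\<close>, so the Schatten norm of L is a norm of its
  spectrum.\<close>

lemma orthonormal_eigenbasis_square: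
  assumes "transpose L = L" and "orthonormal_eigenbasis L w l"
  shows "orthonormal_eigenbasis (transpose L ** L) w (\<lambda>i. (l i)\<^sup>2)"
  using assms
  by (simp add: orthonormal_eigenbasis_def power2_eq_square matrix_vector_mult_scaleR
      flip: matrix_vector_mul_assoc)

lemma inner_matrix_inv_eigenbasis:
  assumes L: "sym_pos_def L" and eb: "orthonormal_eigenbasis L w l"
  shows "y \<bullet> (matrix_inv L *v y) = (\<Sum>i\<in>UNIV. (y \<bullet> w i)\<^sup>2 / l i)"
proof -
  from eb have w: "w i \<bullet> w j = (if i = j then 1 else 0)" and Lw: "L *v w i = l i *\<^sub>R w i" for i j
    by (auto simp: orthonormal_eigenbasis_def)
  \<comment> \<open>Positive definiteness gives a trivial kernel, so \<open>matrix_inv\<close>,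
    defined by choice, is a genuine inverse here.\<close>
  have "x = 0" if "L *v x = 0" for x
  proof (rule ccontr)
    assume "x \<noteq> 0"
    then have "0 < x \<bullet> (L *v x)" using L by (simp add: sym_pos_def_def)
    then show False using that by simp
  qed
  then have "\<exists>B. B ** L = mat 1"
    by (simp add: matrix_left_invertible_ker)
  then have "invertible L"
    by (simp add: invertible_left_inverse)
  then have KL: "matrix_inv L ** L = mat 1"
    unfolding invertible_def matrix_inv_def by (rule someI2_ex) auto
  have Kw: "matrix_inv L *v w i = (1 / l i) *\<^sub>R w i" for i
  proof -
    have "l i *\<^sub>R (matrix_inv L *v w i) = w i"
      by (metis KL Lw matrix_vector_mul_assoc matrix_vector_mul_lid matrix_vector_mult_scaleR)
    then have "(1 / l i) *\<^sub>R (l i *\<^sub>R (matrix_inv L *v w i)) = (1 / l i) *\<^sub>R w i"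
      by simp
    then show ?thesis using sym_pos_def_eigenvalue_pos[OF L eb, of i] by simp
  qed
  have "matrix_inv L *v y = matrix_inv L *v (\<Sum>i\<in>UNIV. (y \<bullet> w i) *\<^sub>R w i)"
    by (simp add: orthonormal_basis_expansion[OF w])
  also have "\<dots> = (\<Sum>i\<in>UNIV. (y \<bullet> w i) *\<^sub>R (1 / l i) *\<^sub>R w i)"
    by (simp add: linear_sum[OF matrix_vector_mul_linear] matrix_vector_mult_scaleR Kw)
  finally show ?thesis
    by (simp add: inner_sum_right power2_eq_square)
qed

lemma schatten_norm_sq_le_trace:
  fixes Z :: "real^'n^'m" and L :: "real^'m^'m"
  assumes L: "sym_pos_def L" and q: "q \<in> {1..2}"
  shows "(schatten_norm (ereal q) Z)\<^sup>2 \<le>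
    schatten_norm (if q = 2 then \<infinity> else ereal (q / (2 - q))) L *
      trace ((Z ** transpose Z) ** matrix_inv L)"
proof -
  have sym: "transpose L = L" using L by (simp add: sym_pos_def_def)
  obtain w l where eb: "orthonormal_eigenbasis L w l"
    using orthonormal_eigenbasis_exists[OF sym] .
  note l = sym_pos_def_eigenvalue_pos[OF L eb]
    and eb2 = orthonormal_eigenbasis_square[OF sym eb]
    and K = inner_matrix_inv_eigenbasis[OF L eb]
  from eb have w: "w i \<bullet> w j = (if i = j then 1 else 0)" for i j
    by (auto simp: orthonormal_eigenbasis_def)
  obtain v d where ebZ: "orthonormal_eigenbasis (transpose Z ** Z) v d"
    by (rule orthonormal_eigenbasis_exists[of "transpose Z ** Z"])
      (simp add: matrix_transpose_mul)
  from ebZ have v: "v i \<bullet> v j = (if i = j then 1 else 0)" for i j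
    by (auto simp: orthonormal_eigenbasis_def)
  note ZvZv = eigenvalue_gram_nonneg(1)[OF ebZ] and d_nn = eigenvalue_gram_nonneg(2)[OF ebZ]
  \<comment> \<open>Division by \<open>d j\<close> makes sense only here; the other indices
    contribute 0 both to the norm and to the trace.\<close>
  define J where "J = {j. d j > 0}"
  have notJ: "d j = 0" "Z *v v j = 0" if "j \<notin> J" for j
  proof -
    show "d j = 0" using that d_nn[of j] by (simp add: J_def)
    then show "Z *v v j = 0" using ZvZv[of j j] by simp
  qed
  \<comment> \<open>On \<open>J\<close> this is (u_j . w_i)^2 with u_j = Z v_j / sqrt (d j).\<close>
  define c where "c j i = ((Z *v v j) \<bullet> w i)\<^sup>2 / d j" for j i
  have c: "c j i \<ge> 0" for j i
    using d_nn by (simp add: c_def)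
  have row: "(\<Sum>i\<in>UNIV. c j i) = 1" if "j \<in> J" for j
  proof -
    have "(\<Sum>i\<in>UNIV. c j i) = (\<Sum>i\<in>UNIV. ((Z *v v j) \<bullet> w i) * ((Z *v v j) \<bullet> w i)) / d j"
      by (simp add: c_def sum_divide_distrib power2_eq_square)
    also have "\<dots> = d j / d j"
      by (simp add: orthonormal_basis_inner[OF w] ZvZv)
    finally show ?thesis using that by (simp add: J_def)
  qed
  have col: "(\<Sum>j\<in>J. c j i) \<le> 1" for i
  proof -
    define u where "u j = (1 / sqrt (d j)) *\<^sub>R (Z *v v j)" for j
    have "u i \<bullet> u j = (if i = j then 1 else 0)" if "i \<in> J" "j \<in> J" for i j
      using that by (simp add: u_def ZvZv J_def)
    then have "(\<Sum>j\<in>J. (u j \<bullet> w i)\<^sup>2) \<le> w i \<bullet> w i"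
      by (intro Bessel_inequality) auto
    moreover have "(u j \<bullet> w i)\<^sup>2 = c j i" for j
      using d_nn[of j] by (simp add: u_def c_def power_divide)
    ultimately show ?thesis by (simp add: w)
  qed
  \<comment> \<open>Cycling the trace gives a matrix on the domain of \<open>Z\<close>, where the
    basis \<open>v\<close> can be used; its diagonal terms are the values of the form of L^-1 at
    \<open>Z *v v j\<close>.\<close>
  have "trace ((Z ** transpose Z) ** matrix_inv L) = trace (transpose Z ** (matrix_inv L ** Z))"
    by (metis matrix_mul_assoc trace_mul_sym)
  also have "\<dots> = (\<Sum>j\<in>UNIV. \<Sum>i\<in>UNIV. ((Z *v v j) \<bullet> w i)\<^sup>2 / l i)"
    unfolding trace_orthonormal_basis[OF v] inner_transpose_mult
    by (simp add: K flip: matrix_vector_mul_assoc)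
  also have "\<dots> = (\<Sum>j\<in>J. \<Sum>i\<in>UNIV. ((Z *v v j) \<bullet> w i)\<^sup>2 / l i)"
    by (rule sum.mono_neutral_right) (auto simp: notJ)
  also have "\<dots> = (\<Sum>j\<in>J. d j * (\<Sum>i\<in>UNIV. c j i / l i))"
    by (auto simp: c_def J_def sum_distrib_left intro!: sum.cong)
  finally have tr: "trace ((Z ** transpose Z) ** matrix_inv L) = (\<Sum>j\<in>J. d j * (\<Sum>i\<in>UNIV. c j i / l i))" .
  have "(schatten_norm (ereal q) Z)\<^sup>2 = (\<Sum>j\<in>UNIV. d j powr (q / 2)) powr (2 / q)"
    using q by (intro schatten_norm_sq_eigenbasis[OF ebZ]) auto
  also have "(\<Sum>j\<in>UNIV. d j powr (q / 2)) = (\<Sum>j\<in>J. d j powr (q / 2))"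
    by (rule sum.mono_neutral_right) (auto simp: notJ)
  finally have sZ: "(schatten_norm (ereal q) Z)\<^sup>2 = (\<Sum>j\<in>J. d j powr (q / 2)) powr (2 / q)" .
  show ?thesis
  proof (cases "q = 2")
    case True
    have "schatten_norm \<infinity> L = Max (range l)"
      using less_imp_le[OF l]
      by (simp add: schatten_norm_def singular_values_eigenbasis[OF eb2] lr_norm_def image_image)
    moreover have "(schatten_norm (ereal q) Z)\<^sup>2 = (\<Sum>j\<in>J. d j)"
      unfolding sZ using True d_nn by (simp add: sum_nonneg)
    moreover have "(\<Sum>j\<in>J. d j) \<le> Max (range l) * (\<Sum>j\<in>J. d j * (\<Sum>i\<in>UNIV. c j i / l i))"
      by (intro weighted_sum_bound_Max c row l) (auto simp: J_def)
    ultimately show ?thesis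
      using True by (simp add: tr)
  next
    case False
    have "q / (2 - q) \<noteq> 0"
      using False q by simp
    then have "schatten_norm (ereal (q / (2 - q))) L
        = (\<Sum>i\<in>UNIV. l i powr (q / (2 - q))) powr (1 / (q / (2 - q)))"
      using less_imp_le[OF l] by (subst schatten_norm_eigenbasis[OF eb2]) simp_all
    moreover have "(\<Sum>j\<in>J. d j powr (q / 2)) powr (2 / q) \<le>
       (\<Sum>i\<in>UNIV. l i powr (q / (2 - q))) powr (1 / (q / (2 - q))) *
         (\<Sum>j\<in>J. d j * (\<Sum>i\<in>UNIV. c j i / l i))"
      using False q by (intro weighted_powr_sum_bound c row col l) (auto simp: J_def)
    ultimately show ?thesis
      using False by (simp add: sZ tr)
  qed
qed

section \<open>Measurability of the Schatten norm\<close>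

lemma funpow_mult_eigenvector:
  fixes X :: "real^'n^'n"
  assumes "X *v x = c *\<^sub>R x"
  shows "((**) X ^^ k) (mat 1) *v x = c ^ k *\<^sub>R x"
  by (induction k) (simp_all add: assms matrix_vector_mult_scaleR flip: matrix_vector_mul_assoc)

text \<open>Power sums of the eigenvalues are polynomial in the matrix entries, hence continuous,
  even though individual eigenvalues were obtained by choice. The iterate is the k-th matrix
  power.\<close>

lemma trace_funpow_eigenbasis:
  fixes X :: "real^'n^'n"
  assumes "orthonormal_eigenbasis X w d"
  shows "trace (((**) X ^^ k) (mat 1)) = (\<Sum>j\<in>UNIV. d j ^ k)"
proof -
  have w: "w i \<bullet> w j = (if i = j then 1 else 0)" and Xw: "X *v w i = d i *\<^sub>R w i" for i j
    using assms by (auto simp: orthonormal_eigenbasis_def)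
  show ?thesis
    by (simp add: trace_orthonormal_basis[OF w] funpow_mult_eigenvector[OF Xw] w)
qed

lemma continuous_on_trace_funpow:
  "continuous_on UNIV (\<lambda>X :: real^'n^'n. trace (((**) X ^^ k) (mat 1)))"
proof -
  have "continuous_on UNIV (\<lambda>X :: real^'n^'n. ((**) X ^^ k) (mat 1) $ i $ j)" for i j
  proof (induction k arbitrary: i j)
    case (Suc k)
    then show ?case
      by (simp add: matrix_matrix_mult_def[of X "((**) X ^^ k) (mat 1)" for X])
        (intro continuous_on_sum continuous_on_mult Suc continuous_on_component continuous_on_id)
  qed simp
  then show ?thesis
    by (auto simp: trace_def intro!: continuous_on_sum)
qed

lemma continuous_on_gram: "continuous_on UNIV (\<lambda>Z :: real^'n^'m. transpose Z ** Z)"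
  unfolding transpose_def matrix_matrix_mult_def
  by (intro continuous_on_vec_lambda continuous_intros)

text \<open>By Weierstrass, \<open>\<Sum>\<^sub>j d\<^sub>j powr (r / 2)\<close> over the eigenvalues \<open>d\<^sub>j\<close> of \<open>Z\<^sup>T Z\<close> is a pointwise
  limit of linear combinations of traces of powers of \<open>Z\<^sup>T Z\<close>.\<close>
lemma borel_measurable_schatten_norm_sq:
  assumes r: "r > 0"
  shows "(\<lambda>Z :: real^'n^'m. (schatten_norm (ereal r) Z)\<^sup>2) \<in> borel_measurable borel"
proof -
  \<comment> \<open>The eigenbasis is picked separately for each \<open>Z\<close>, with no
    regularity in \<open>Z\<close>; measurability is claimed only for the symmetric sum
    \<open>F\<close>.\<close>
  have "\<exists>w d. orthonormal_eigenbasis (transpose Z ** Z) w d" for Z :: "real^'n^'m"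
    by (rule orthonormal_eigenbasis_exists[of "transpose Z ** Z"]) (auto simp: matrix_transpose_mul)
  then obtain w d where eb: "\<And>Z :: real^'n^'m. orthonormal_eigenbasis (transpose Z ** Z) (w Z) (d Z)"
    by metis
  define F where "F Z = (\<Sum>j\<in>UNIV. d Z j powr (r / 2))" for Z
  \<comment> \<open>Eigenvalues range over an unbounded set, so the interval grows with n while the
    error shrinks; every fixed \<open>x \<ge> 0\<close> is eventually covered.\<close>
  have "\<exists>a m. \<forall>x\<in>{0..real n}. \<bar>x powr (r / 2) - (\<Sum>k\<le>m. a k * x ^ k)\<bar> < inverse (real (Suc n))"
    for n :: nat
  proof -
    have "continuous_on {0..real n} (\<lambda>x. x powr (r / 2))"
      using r by (intro continuous_on_powr' continuous_intros) auto
    then obtain g where "real_polynomial_function g"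
        "\<And>x. x \<in> {0..real n} \<Longrightarrow> \<bar>x powr (r / 2) - g x\<bar> < inverse (real (Suc n))"
      using Stone_Weierstrass_real_polynomial_function[of "{0..real n}" "\<lambda>x. x powr (r / 2)"
          "inverse (real (Suc n))"] by auto
    then show ?thesis
      by (metis real_polynomial_function_imp_sum)
  qed
  then obtain a :: "nat \<Rightarrow> nat \<Rightarrow> real" and m where
    a: "\<And>n x. x \<in> {0..real n} \<Longrightarrow> \<bar>x powr (r / 2) - (\<Sum>k\<le>m n. a n k * x ^ k)\<bar> < inverse (real (Suc n))"
    by metis
  define P where "P n x = (\<Sum>k\<le>m n. a n k * x ^ k)" for n x
  have lim: "(\<lambda>n. P n x) \<longlonglongrightarrow> x powr (r / 2)" if "x \<ge> 0" for x
  proof -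
    have "(\<lambda>n. P n x - x powr (r / 2)) \<longlonglongrightarrow> 0"
    proof (rule Lim_null_comparison[OF _ LIMSEQ_inverse_real_of_nat])
      obtain N where "x \<le> real N" using real_arch_simple by blast
      then have "\<forall>n\<ge>N. \<bar>x powr (r / 2) - P n x\<bar> < inverse (real (Suc n))"
        using a that by (simp add: P_def del: of_nat_Suc)
      then show "\<forall>\<^sub>F n in sequentially. norm (P n x - x powr (r / 2)) \<le> inverse (real (Suc n))"
        unfolding eventually_sequentially by (metis abs_minus_commute less_imp_le real_norm_def)
    qed
    then show ?thesis by (simp add: LIM_zero_iff)
  qed
  have PF: "(\<Sum>j\<in>UNIV. P n (d Z j)) = (\<Sum>k\<le>m n. a n k * trace (((**) (transpose Z ** Z) ^^ k) (mat 1)))" for n Z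
    unfolding P_def trace_funpow_eigenbasis[OF eb] sum_distrib_left by (rule sum.swap)
  have "F \<in> borel_measurable borel"
  proof (rule borel_measurable_LIMSEQ_real)
    show "(\<lambda>n. \<Sum>j\<in>UNIV. P n (d Z j)) \<longlonglongrightarrow> F Z" for Z
      unfolding F_def by (intro tendsto_sum lim eigenvalue_gram_nonneg(2)[OF eb])
    show "(\<lambda>Z. \<Sum>j\<in>UNIV. P n (d Z j)) \<in> borel_measurable borel" for n
      unfolding PF
      by (intro borel_measurable_continuous_onI continuous_on_sum continuous_on_mult continuous_on_const
          continuous_on_compose2[OF continuous_on_trace_funpow continuous_on_gram]) auto
  qed
  then have "(\<lambda>Z. F Z powr (2 / r)) \<in> borel_measurable borel"
    by measurable
  then show ?thesis
    by (simp add: F_def schatten_norm_sq_eigenbasis[OF eb r])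
qed

section \<open>Orthogonality and second moments of martingale differences\<close>

lemma integrable_matrix:
  fixes X :: "'a \<Rightarrow> real^'n^'m"
  assumes "\<And>i j. integrable M (\<lambda>\<omega>. X \<omega> $ i $ j)"
  shows "integrable M X"
proof -
  have "Y = (\<Sum>i\<in>UNIV. \<Sum>j\<in>UNIV. Y $ i $ j *\<^sub>R axis i (axis j 1))" for Y :: "real^'n^'m"
  proof -
    have "Y $ i $ j * axis i (axis j (1 :: real)) $ a $ b = (if j = b then if i = a then Y $ i $ j else 0 else 0)"
      for i a :: 'm and j b :: 'n
      by (simp add: axis_def)
    then show ?thesis by (simp add: vec_eq_iff)
  qed
  then have "X = (\<lambda>\<omega>. \<Sum>i\<in>UNIV. \<Sum>j\<in>UNIV. X \<omega> $ i $ j *\<^sub>R axis i (axis j 1))"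
    by blast
  moreover have "integrable M (\<lambda>\<omega>. \<Sum>i\<in>UNIV. \<Sum>j\<in>UNIV. X \<omega> $ i $ j *\<^sub>R (axis i (axis j 1) :: real^'n^'m))"
    by (intro Bochner_Integration.integrable_sum integrable_scaleR_left assms)
  ultimately show ?thesis by simp
qed

lemma bounded_linear_entry: "bounded_linear (\<lambda>X :: real^'n^'m. X $ i $ j)"
  using bounded_linear_compose[OF bounded_linear_vec_nth bounded_linear_vec_nth] .

lemma integral_matrix_nth:
  fixes X :: "'a \<Rightarrow> real^'n^'m"
  assumes "integrable M X"
  shows "(\<integral>\<omega>. X \<omega> \<partial>M) $ i $ j = (\<integral>\<omega>. X \<omega> $ i $ j \<partial>M)"
  by (rule integral_bounded_linear[OF bounded_linear_entry assms, symmetric])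

lemma borel_measurable_matrix_nth:
  fixes X :: "'a \<Rightarrow> real^'n^'m"
  assumes "X \<in> borel_measurable M"
  shows "(\<lambda>\<omega>. X \<omega> $ i $ j) \<in> borel_measurable M"
  by (rule measurable_compose[OF assms])
    (intro borel_measurable_continuous_onI linear_continuous_on bounded_linear_entry)

lemma integrable_mult_square_integrable:
  fixes f g :: "'a \<Rightarrow> real"
  assumes [measurable]: "f \<in> borel_measurable M" "g \<in> borel_measurable M"
    and "integrable M (\<lambda>\<omega>. (f \<omega>)\<^sup>2)" "integrable M (\<lambda>\<omega>. (g \<omega>)\<^sup>2)"
  shows "integrable M (\<lambda>\<omega>. f \<omega> * g \<omega>)"
proof (rule Bochner_Integration.integrable_bound)
  show "integrable M (\<lambda>\<omega>. (f \<omega>)\<^sup>2 + (g \<omega>)\<^sup>2)"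
    using assms by simp
  have "\<bar>x * y\<bar> \<le> x\<^sup>2 + y\<^sup>2" for x y :: real
    using sum_squares_bound[of "\<bar>x\<bar>" "\<bar>y\<bar>"] abs_ge_zero[of "x * y"]
    unfolding abs_mult power2_abs by linarith
  then show "AE \<omega> in M. norm (f \<omega> * g \<omega>) \<le> norm ((f \<omega>)\<^sup>2 + (g \<omega>)\<^sup>2)"
    by (auto intro!: AE_I2)
qed measurable

lemma subalgebra_natural_filtration:
  assumes "\<And>s. X s \<in> borel_measurable M"
  shows "subalgebra M (natural_filtration M X t)"
proof -
  have "(\<Union>s\<in>{..t}. {X s -` B \<inter> space M |B. B \<in> sets borel}) \<subseteq> sets M"
    using assms by (auto simp: measurable_def)
  moreover from this have "(\<Union>s\<in>{..t}. {X s -` B \<inter> space M |B. B \<in> sets borel}) \<subseteq> Pow (space M)"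
    using sets.space_closed by blast
  ultimately show ?thesis
    by (simp add: subalgebra_def natural_filtration_def sets.sigma_sets_subset)
qed

lemma borel_measurable_natural_filtration:
  assumes "s \<le> t"
  shows "X s \<in> borel_measurable (natural_filtration M X t)"
proof (rule measurableI)
  have sub: "(\<Union>s\<in>{..t}. {X s -` B \<inter> space M |B. B \<in> sets borel}) \<subseteq> Pow (space M)" by auto
  fix B :: "'b set" assume "B \<in> sets borel"
  then show "X s -` B \<inter> space (natural_filtration M X t) \<in> sets (natural_filtration M X t)"
    using assms sub by (auto simp: natural_filtration_def)
qed auto

text \<open>Since \<open>s \<le> t - 1\<close>, the earlier entry is measurable for the filtration
  at t - 1, so the later one may be replaced by its conditional expectation, which is 0 almost
  everywhere. Square integrability makes the product integrable.\<close>

lemma martingale_difference_orthogonal: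
  fixes A :: "nat \<Rightarrow> 'a \<Rightarrow> real^'n^'m"
  assumes "prob_space M"
    and meas: "\<And>t. A t \<in> borel_measurable M"
    and md: "martingale_difference M A"
    and sq: "\<And>t i j. integrable M (\<lambda>\<omega>. (A t \<omega> $ i $ j)\<^sup>2)"
    and "s < t"
  shows "(\<integral>\<omega>. A s \<omega> $ i $ j * A t \<omega> $ i' $ j' \<partial>M) = 0"
proof -
  interpret prob_space M by fact
  define F where "F = natural_filtration M A (t - 1)"
  interpret finite_measure_subalgebra M F
    by standard (simp add: F_def subalgebra_natural_filtration meas)
  note entry = borel_measurable_matrix_nth[OF meas]
  have As: "(\<lambda>\<omega>. A s \<omega> $ i $ j) \<in> borel_measurable F"
    unfolding F_def using \<open>s < t\<close>
    by (intro borel_measurable_matrix_nth borel_measurable_natural_filtration) auto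
  have int: "integrable M (\<lambda>\<omega>. A s \<omega> $ i $ j * A t \<omega> $ i' $ j')"
    by (intro integrable_mult_square_integrable entry sq)
  have "t \<ge> 1" using \<open>s < t\<close> by simp
  then have "AE \<omega> in M. matrix_cond_exp M F (A t) \<omega> = 0"
    using md unfolding martingale_difference_def F_def by blast
  then have "AE \<omega> in M. A s \<omega> $ i $ j * real_cond_exp M F (\<lambda>\<omega>. A t \<omega> $ i' $ j') \<omega> = 0"
    by (rule AE_mp) (auto intro!: AE_I2 simp: matrix_cond_exp_def vec_eq_iff)
  then have "(\<integral>\<omega>. A s \<omega> $ i $ j * real_cond_exp M F (\<lambda>\<omega>. A t \<omega> $ i' $ j') \<omega> \<partial>M) = 0"
    by (rule integral_eq_zero_AE)
  then show ?thesis
    using real_cond_exp_intg(2)[OF int As entry] by simp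
qed

lemma matrix_mult_transpose_nth:
  "(X ** transpose Y) $ i $ l = (\<Sum>j\<in>UNIV. X $ i $ j * Y $ l $ j)"
  by (simp add: matrix_matrix_mult_def transpose_def)

text \<open>Expanding the product entrywise gives a double sum over times, of which only the
  diagonal survives integration.\<close>

lemma martingale_difference_second_moment:
  fixes A :: "nat \<Rightarrow> 'a \<Rightarrow> real^'n^'m"
  assumes "prob_space M"
    and meas: "\<And>t. A t \<in> borel_measurable M"
    and md: "martingale_difference M A"
    and int: "\<And>t. integrable M (\<lambda>\<omega>. A t \<omega> ** transpose (A t \<omega>))"
  shows "integrable M (\<lambda>\<omega>. (\<Sum>t<k. A t \<omega>) ** transpose (\<Sum>t<k. A t \<omega>))" (is "integrable M ?S")
    and "(\<integral>\<omega>. (\<Sum>t<k. A t \<omega>) ** transpose (\<Sum>t<k. A t \<omega>) \<partial>M) =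
           (\<Sum>t<k. \<integral>\<omega>. A t \<omega> ** transpose (A t \<omega>) \<partial>M)"
proof -
  note entry[measurable] = borel_measurable_matrix_nth[OF meas]
  have sq: "integrable M (\<lambda>\<omega>. (A t \<omega> $ i $ j)\<^sup>2)" for t i j
  proof (rule Bochner_Integration.integrable_bound)
    show "integrable M (\<lambda>\<omega>. (A t \<omega> ** transpose (A t \<omega>)) $ i $ i)"
      by (rule integrable_bounded_linear[OF bounded_linear_entry int])
    \<comment> \<open>A diagonal entry of X X^T is the sum of squares along a row, so the assumed
      second moment controls every single entry.\<close>
    have "(X $ i $ j)\<^sup>2 \<le> (X ** transpose X) $ i $ i" for X :: "real^'n^'m"
      unfolding matrix_mult_transpose_nth power2_eq_square
      by (rule member_le_sum[of j UNIV "\<lambda>j. X $ i $ j * X $ i $ j"]) auto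
    then show "AE \<omega> in M. norm ((A t \<omega> $ i $ j)\<^sup>2) \<le> norm ((A t \<omega> ** transpose (A t \<omega>)) $ i $ i)"
      by (auto intro!: AE_I2 order_trans[OF _ abs_ge_self])
  qed measurable
  have intp: "integrable M (\<lambda>\<omega>. A s \<omega> $ i $ j * A t \<omega> $ l $ j)" for s t i l j
    by (intro integrable_mult_square_integrable entry sq)
  have orth: "(\<integral>\<omega>. A s \<omega> $ i $ j * A t \<omega> $ l $ j \<partial>M) = 0" if "s \<noteq> t" for s t i l j
    using martingale_difference_orthogonal[OF assms(1) meas md sq, of s t i j l j]
      martingale_difference_orthogonal[OF assms(1) meas md sq, of t s l j i j] that
    by (cases "s < t") (auto simp: mult.commute)
  have S_nth: "?S \<omega> $ i $ l = (\<Sum>j\<in>UNIV. \<Sum>s<k. \<Sum>t<k. A s \<omega> $ i $ j * A t \<omega> $ l $ j)" for \<omega> i l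
    by (simp add: matrix_mult_transpose_nth sum_product)
  show intS: "integrable M ?S"
    by (rule integrable_matrix) (unfold S_nth, intro Bochner_Integration.integrable_sum intp)
  show "(\<integral>\<omega>. ?S \<omega> \<partial>M) = (\<Sum>t<k. \<integral>\<omega>. A t \<omega> ** transpose (A t \<omega>) \<partial>M)"
  proof -
    have "(\<integral>\<omega>. ?S \<omega> \<partial>M) $ i $ l = (\<Sum>t<k. \<integral>\<omega>. A t \<omega> ** transpose (A t \<omega>) \<partial>M) $ i $ l" for i l
    proof -
      have "(\<integral>\<omega>. ?S \<omega> \<partial>M) $ i $ l
          = (\<integral>\<omega>. (\<Sum>j\<in>UNIV. \<Sum>s<k. \<Sum>t<k. A s \<omega> $ i $ j * A t \<omega> $ l $ j) \<partial>M)"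
        by (simp only: integral_matrix_nth[OF intS] S_nth)
      also have "\<dots> = (\<Sum>j\<in>UNIV. \<Sum>s<k. \<Sum>t<k. \<integral>\<omega>. A s \<omega> $ i $ j * A t \<omega> $ l $ j \<partial>M)"
        by (simp add: Bochner_Integration.integral_sum intp)
      also have "\<dots> = (\<Sum>j\<in>UNIV. \<Sum>s<k. \<Sum>t<k.
          if s = t then (\<integral>\<omega>. A s \<omega> $ i $ j * A s \<omega> $ l $ j \<partial>M) else 0)"
        by (intro sum.cong refl) (auto simp: orth)
      also have "\<dots> = (\<Sum>t<k. \<Sum>j\<in>UNIV. \<integral>\<omega>. A t \<omega> $ i $ j * A t \<omega> $ l $ j \<partial>M)"
        by (simp add: sum.swap[of _ "{..<k}"])
      also have "\<dots> = (\<Sum>t<k. \<integral>\<omega>. A t \<omega> ** transpose (A t \<omega>) \<partial>M) $ i $ l"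
        by (simp add: integral_matrix_nth[OF int] matrix_mult_transpose_nth intp)
      finally show ?thesis .
    qed
    then show ?thesis by (simp add: vec_eq_iff)
  qed
qed

section \<open>Passing to expectations\<close>

lemma bounded_linear_trace_mult:
  fixes K :: "real^'n^'n"
  shows "bounded_linear (\<lambda>X. trace (X ** K))"
  unfolding linear_conv_bounded_linear[symmetric]
proof (rule linearI)
  fix X Y :: "real^'n^'n" and c :: real
  show "trace ((X + Y) ** K) = trace (X ** K) + trace (Y ** K)"
    by (simp add: trace_def matrix_matrix_mult_def distrib_right sum.distrib)
  show "trace ((c *\<^sub>R X) ** K) = c *\<^sub>R trace (X ** K)"
    by (simp add: trace_def matrix_matrix_mult_def sum_distrib_left mult_ac)
qed

text \<open>Integrability belongs to the conclusion because a non-integrable function has integral 0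
  by convention, which would empty the bound of content.\<close>

theorem lemma4:
  fixes M :: "'a measure"
    and A :: "nat \<Rightarrow> 'a \<Rightarrow> real ^ 'n ^ 'm"
    and \<Lambda> :: "real ^ 'm ^ 'm"
    and q :: real
  assumes "prob_space M"
    and "\<And>t. A t \<in> borel_measurable M"
    and "martingale_difference M A"
    and "\<And>t. integrable M (\<lambda>\<omega>. A t \<omega> ** transpose (A t \<omega>))"
    and "sym_pos_def \<Lambda>"
    and "q \<in> {1..2}"
  shows "\<forall>k\<ge>1.
    integrable M (\<lambda>\<omega>. (schatten_norm (ereal q) (\<Sum>t<k. A t \<omega>))\<^sup>2) \<and>
    (\<integral>\<omega>. (schatten_norm (ereal q) (\<Sum>t<k. A t \<omega>))\<^sup>2 \<partial>M)
      \<le> schatten_norm (if q = 2 then \<infinity> else ereal (q / (2 - q))) \<Lambda> *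
          (\<Sum>t<k. trace ((\<integral>\<omega>. A t \<omega> ** transpose (A t \<omega>) \<partial>M) ** matrix_inv \<Lambda>))"
proof (intro allI impI)
  fix k :: nat
  let ?c = "schatten_norm (if q = 2 then \<infinity> else ereal (q / (2 - q))) \<Lambda>"
  let ?f = "\<lambda>\<omega>. (schatten_norm (ereal q) (\<Sum>t<k. A t \<omega>))\<^sup>2"
  let ?S = "\<lambda>\<omega>. (\<Sum>t<k. A t \<omega>) ** transpose (\<Sum>t<k. A t \<omega>)"
  let ?g = "\<lambda>\<omega>. ?c * trace (?S \<omega> ** matrix_inv \<Lambda>)"
  note bl = bounded_linear_trace_mult[of "matrix_inv \<Lambda>"]
  note moment = martingale_difference_second_moment[OF assms(1-4), of k]
  have le: "?f \<omega> \<le> ?g \<omega>" for \<omega>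
    by (rule schatten_norm_sq_le_trace[OF assms(5,6)])
  have meas: "?f \<in> borel_measurable M"
    using assms(2,6)
    by (intro measurable_compose[OF _ borel_measurable_schatten_norm_sq] borel_measurable_sum) auto
  have intg: "integrable M ?g"
    by (intro integrable_mult_right integrable_bounded_linear[OF bl] moment(1))
  \<comment> \<open>The pointwise bound serves twice: here as a dominating function, then under the
    integral.\<close>
  have intf: "integrable M ?f"
    by (rule Bochner_Integration.integrable_bound[OF intg meas])
      (use order_trans[OF le abs_ge_self] in simp)
  have "integral\<^sup>L M ?f \<le> integral\<^sup>L M ?g"
    by (intro integral_mono intf intg le)
  also have "integral\<^sup>L M ?g = ?c * trace ((\<Sum>t<k. \<integral>\<omega>. A t \<omega> ** transpose (A t \<omega>) \<partial>M) ** matrix_inv \<Lambda>)"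
    by (simp add: integral_bounded_linear[OF bl moment(1)] moment(2))
  also have "\<dots> = ?c * (\<Sum>t<k. trace ((\<integral>\<omega>. A t \<omega> ** transpose (A t \<omega>) \<partial>M) ** matrix_inv \<Lambda>))"
    by (simp add: linear_sum[OF bounded_linear.linear[OF bl]])
  finally show "integrable M ?f \<and> integral\<^sup>L M ?f
      \<le> ?c * (\<Sum>t<k. trace ((\<integral>\<omega>. A t \<omega> ** transpose (A t \<omega>) \<partial>M) ** matrix_inv \<Lambda>))"
    using intf by simp
qed

end
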